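(* Let $(\mathfrak g,\cdot,\ast)$ be a compatible pre-Lie algebra over a field $\mathbb K$, and let $(\mathfrak g,\cdot_t,\ast_t)$ be a trivial infinitesimal deformation of $(\mathfrak g,\cdot,\ast)$ generated by $(\omega_1,\omega_2)$, with $N\in\mathfrak{gl}(\mathfrak g)$ a linear operator such that, for all $t\in\mathbb K$, $\mathrm{Id}+tN$ is a compatible pre-Lie algebra homomorphism from $(\mathfrak g,\cdot_t,\ast_t)$ to $(\mathfrak g,\cdot,\ast)$. Then $N$ is a Nijenhuis operator on the compatible pre-Lie algebra $(\mathfrak g,\cdot,\ast)$.
   Context: Pre-Lie algebra: a vector space with a bilinear product $\cdot$ satisfying $(x\cdot y)\cdot z-x\cdot(y\cdot z)=(y\cdot x)\cdot z-y\cdot(x\cdot z)$. Compatible pre-Lie algebra: a triple $(\mathfrak g,\cdot,\ast)$ where $\cdot$ and $\ast$ are pre-Lie products on $\mathfrak g$ such that for all $x,y,z$: $(x\ast y)\cdot z+(x\cdot y)\ast z-x\cdot(y\ast z)-x\ast(y\cdot z)-(y\ast x)\cdot z-(y\cdot x)\ast z+y\cdot(x\ast z)+y\ast(x\cdot z)=0$. A homomorphism of compatible pre-Lie algebras is a linear map preserving both products. Infinitesimal deformation: a pair $(\omega_1,\omega_2)$ of elements of $\mathrm{Hom}(\otimes^2\mathfrak g,\mathfrak g)$ generates an infinitesimal deformation of $(\mathfrak g,\cdot,\ast)$ if for all $t\in\mathbb K$ the products $x\cdot_ty=x\cdot y+t\omega_1(x,y)$, $x\ast_ty=x\ast y+t\omega_2(x,y)$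 make $(\mathfrak g,\cdot_t,\ast_t)$ a compatible pre-Lie algebra. It is trivial if there is $N\in\mathfrak{gl}(\mathfrak g)$ such that $\mathrm{Id}+tN$ is a compatible pre-Lie algebra homomorphism from $(\mathfrak g,\cdot_t,\ast_t)$ to $(\mathfrak g,\cdot,\ast)$ for all $t\in\mathbb K$. Nijenhuis operator: $N\in\mathfrak{gl}(\mathfrak g)$ is a Nijenhuis operator on a pre-Lie algebra $(\mathfrak g,\cdot)$ if $N(x)\cdot N(y)=N\big(N(x)\cdot y+x\cdot N(y)-N(x\cdot y)\big)$ for all $x,y$; it is a Nijenhuis operator on the compatible pre-Lie algebra $(\mathfrak g,\cdot,\ast)$ if it is a Nijenhuis operator on both $(\mathfrak g,\cdot)$ and $(\mathfrak g,\ast)$.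
   Formalization: The field K is assumed to have more than two elements; over the two-element field the claim as stated is false, since the homomorphism condition only has to hold for t = 0 and t = 1. *)

theory Defs
  imports Complex_Main
begin

definition bilinear_map ::
    "('k::field \<Rightarrow> 'g::ab_group_add \<Rightarrow> 'g) \<Rightarrow> ('g \<Rightarrow> 'g \<Rightarrow> 'g) \<Rightarrow> bool" where
  "bilinear_map scale f \<longleftrightarrow>
     (\<forall>x. Vector_Spaces.linear scale scale (\<lambda>y. f x y)) \<and>
     (\<forall>y. Vector_Spaces.linear scale scale (\<lambda>x. f x y))"

locale pre_lie_algebra = vector_space scale
  for scale :: "'k::field \<Rightarrow> 'g::ab_group_add \<Rightarrow> 'g" +
  fixes mul :: "'g \<Rightarrow> 'g \<Rightarrow> 'g"  (infixl \<open>\<cdot>\<close> 70)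
  assumes bilinear_mul: "bilinear_map scale (\<cdot>)"
    and associator_symmetric:
      "(x \<cdot> y) \<cdot> z - x \<cdot> (y \<cdot> z) = (y \<cdot> x) \<cdot> z - y \<cdot> (x \<cdot> z)"

locale compatible_pre_lie_algebra =
  dot: pre_lie_algebra scale dot + ast: pre_lie_algebra scale ast
  for scale :: "'k::field \<Rightarrow> 'g::ab_group_add \<Rightarrow> 'g"
    and dot :: "'g \<Rightarrow> 'g \<Rightarrow> 'g"  (infixl \<open>\<cdot>\<close> 70)
    and ast :: "'g \<Rightarrow> 'g \<Rightarrow> 'g"  (infixl \<open>\<star>\<close> 70) +
  assumes compatibility:
    "(x \<star> y) \<cdot> z + (x \<cdot> y) \<star> z - x \<cdot> (y \<star> z) - x \<star> (y \<cdot> z)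
      - (y \<star> x) \<cdot> z - (y \<cdot> x) \<star> z + y \<cdot> (x \<star> z) + y \<star> (x \<cdot> z) = 0"

locale compatible_pre_lie_hom =
  source: compatible_pre_lie_algebra scale1 dot1 ast1 +
  target: compatible_pre_lie_algebra scale2 dot2 ast2 +
  Vector_Spaces.linear scale1 scale2 f
  for scale1 :: "'k::field \<Rightarrow> 'g::ab_group_add \<Rightarrow> 'g"
    and dot1 :: "'g \<Rightarrow> 'g \<Rightarrow> 'g" and ast1 :: "'g \<Rightarrow> 'g \<Rightarrow> 'g"
    and scale2 :: "'k \<Rightarrow> 'h::ab_group_add \<Rightarrow> 'h"
    and dot2 :: "'h \<Rightarrow> 'h \<Rightarrow> 'h" and ast2 :: "'h \<Rightarrow> 'h \<Rightarrow> 'h"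
    and f :: "'g \<Rightarrow> 'h" +
  assumes hom_dot: "f (dot1 x y) = dot2 (f x) (f y)"
    and hom_ast: "f (ast1 x y) = ast2 (f x) (f y)"

definition deformed_mul ::
    "('k::field \<Rightarrow> 'g::ab_group_add \<Rightarrow> 'g) \<Rightarrow> ('g \<Rightarrow> 'g \<Rightarrow> 'g) \<Rightarrow> ('g \<Rightarrow> 'g \<Rightarrow> 'g)
      \<Rightarrow> 'k \<Rightarrow> 'g \<Rightarrow> 'g \<Rightarrow> 'g" where
  "deformed_mul scale mul \<omega> t x y = mul x y + scale t (\<omega> x y)"

definition infinitesimal_deformation ::
    "('k::field \<Rightarrow> 'g::ab_group_add \<Rightarrow> 'g) \<Rightarrow> ('g \<Rightarrow> 'g \<Rightarrow> 'g) \<Rightarrow> ('g \<Rightarrow> 'g \<Rightarrow> 'g)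
      \<Rightarrow> ('g \<Rightarrow> 'g \<Rightarrow> 'g) \<Rightarrow> ('g \<Rightarrow> 'g \<Rightarrow> 'g) \<Rightarrow> bool" where
  "infinitesimal_deformation scale dot ast \<omega>1 \<omega>2 \<longleftrightarrow>
     bilinear_map scale \<omega>1 \<and> bilinear_map scale \<omega>2 \<and>
     (\<forall>t. compatible_pre_lie_algebra scale
            (deformed_mul scale dot \<omega>1 t) (deformed_mul scale ast \<omega>2 t))"

(* Each t gives the identity
     (w x y + N (x . y) - N x . y - x . N y) + t (N (w x y) - N x . N y) = 0  for t nonzero,
   so both coefficients vanish only if t takes two distinct nonzero values. Over the
   two-element field only their sum vanishes, and N need not be a Nijenhuis operator. *)
definition trivializes_deformation ::
    "('k::field \<Rightarrow> 'g::ab_group_add \<Rightarrow> 'g) \<Rightarrow> ('g \<Rightarrow> 'g \<Rightarrow> 'g) \<Rightarrow> ('g \<Rightarrow> 'g \<Rightarrow> 'g)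
      \<Rightarrow> ('g \<Rightarrow> 'g \<Rightarrow> 'g) \<Rightarrow> ('g \<Rightarrow> 'g \<Rightarrow> 'g) \<Rightarrow> ('g \<Rightarrow> 'g) \<Rightarrow> bool" where
  "trivializes_deformation scale dot ast \<omega>1 \<omega>2 N \<longleftrightarrow>
     Vector_Spaces.linear scale scale N \<and>
     (\<forall>t. compatible_pre_lie_hom
            scale (deformed_mul scale dot \<omega>1 t) (deformed_mul scale ast \<omega>2 t)
            scale dot ast
            (\<lambda>x. x + scale t (N x)))"

definition trivial_infinitesimal_deformation ::
    "('k::field \<Rightarrow> 'g::ab_group_add \<Rightarrow> 'g) \<Rightarrow> ('g \<Rightarrow> 'g \<Rightarrow> 'g) \<Rightarrow> ('g \<Rightarrow> 'g \<Rightarrow> 'g)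
      \<Rightarrow> ('g \<Rightarrow> 'g \<Rightarrow> 'g) \<Rightarrow> ('g \<Rightarrow> 'g \<Rightarrow> 'g) \<Rightarrow> bool" where
  "trivial_infinitesimal_deformation scale dot ast \<omega>1 \<omega>2 \<longleftrightarrow>
     infinitesimal_deformation scale dot ast \<omega>1 \<omega>2 \<and>
     (\<exists>N. trivializes_deformation scale dot ast \<omega>1 \<omega>2 N)"

definition nijenhuis_operator ::
    "('k::field \<Rightarrow> 'g::ab_group_add \<Rightarrow> 'g) \<Rightarrow> ('g \<Rightarrow> 'g \<Rightarrow> 'g) \<Rightarrow> ('g \<Rightarrow> 'g) \<Rightarrow> bool" where
  "nijenhuis_operator scale mul N \<longleftrightarrow>
     pre_lie_algebra scale mul \<and> Vector_Spaces.linear scale scale N \<and>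
     (\<forall>x y. mul (N x) (N y) = N (mul (N x) y + mul x (N y) - N (mul x y)))"

definition compatible_nijenhuis_operator ::
    "('k::field \<Rightarrow> 'g::ab_group_add \<Rightarrow> 'g) \<Rightarrow> ('g \<Rightarrow> 'g \<Rightarrow> 'g) \<Rightarrow> ('g \<Rightarrow> 'g \<Rightarrow> 'g)
      \<Rightarrow> ('g \<Rightarrow> 'g) \<Rightarrow> bool" where
  "compatible_nijenhuis_operator scale dot ast N \<longleftrightarrow>
     compatible_pre_lie_algebra scale dot ast \<and>
     nijenhuis_operator scale dot N \<and> nijenhuis_operator scale ast N"

end

(* Comparing the two sides of the homomorphism equation for Id + tN gives t A + t^2 B = 0 with
   A = \<omega>(x, y) + N (x . y) - N x . y - x . N y and B = N (\<omega>(x, y)) - N x . N y.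
   Evaluating at t = 1 and at some t outside {0, 1} yields A = B = 0, and applying N to A = 0
   turns B = 0 into the Nijenhuis identity. *)
theory Submission
  imports Defs
begin

text \<open>Substituting \<open>a = - b\<close> into the second equation leaves
  \<open>s * (s - 1)\<close> times \<open>b\<close>, and this scalar is invertible because
  \<open>s\<close> is neither 0 nor 1.\<close>

lemma (in vector_space) linear_quadratic_coeffs_zero:
  assumes "s \<noteq> 0" "s \<noteq> 1" "a + b = 0" "scale s a + scale (s * s) b = 0"
  shows "a = 0" "b = 0"
proof -
  have "a = - b"
    using assms(3) by (simp add: eq_neg_iff_add_eq_0)
  with assms(4) have "scale (s * (s - 1)) b = 0"
    by (simp add: scale_left_diff_distrib right_diff_distrib)
  with assms(1,2) show "b = 0"
    by simp
  with \<open>a = - b\<close> show "a = 0"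
    by simp
qed

text \<open>The Nijenhuis condition concerns one product at a time, so this serves both
  \<open>dot\<close> and \<open>ast\<close>. Assumption \<open>hom\<close> is multiplicativity of Id
  + tN, for every t.\<close>

lemma nijenhuis_operator_if_deformed_hom:
  fixes scale :: "'k::field \<Rightarrow> 'g::ab_group_add \<Rightarrow> 'g"
  assumes "(UNIV :: 'k set) \<noteq> {0, 1}"
    and mul: "pre_lie_algebra scale mul"
    and N: "Vector_Spaces.linear scale scale N"
    and hom: "\<And>t x y. deformed_mul scale mul \<omega> t x y
        + scale t (N (deformed_mul scale mul \<omega> t x y))
      = mul (x + scale t (N x)) (y + scale t (N y))"
  shows "nijenhuis_operator scale mul N"
proof -
  interpret pre_lie_algebra scale mul by (rule mul)
  interpret N: Vector_Spaces.linear scale scale N by (rule N)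
  interpret R: Vector_Spaces.linear scale scale "mul x" for x
    using bilinear_mul by (simp add: bilinear_map_def)
  interpret L: Vector_Spaces.linear scale scale "\<lambda>x. mul x y" for y
    using bilinear_mul by (simp add: bilinear_map_def)
  \<comment> \<open>A third scalar separates t from t^2; on 0 and 1 the two agree.\<close>
  obtain s :: 'k where s: "s \<noteq> 0" "s \<noteq> 1"
    using assms(1) by auto
  have "mul (N x) (N y) = N (mul (N x) y + mul x (N y) - N (mul x y))" for x y
  proof -
    define a where "a = \<omega> x y + N (mul x y) - mul (N x) y - mul x (N y)"
    define b where "b = N (\<omega> x y) - mul (N x) (N y)"
    \<comment> \<open>Expanding both sides of \<open>hom\<close> by bilinearity, the constant term
      \<open>mul x y\<close> cancels; \<open>a\<close> and \<open>b\<close> collect the terms in t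
      and t^2.\<close>
    have poly: "scale t a + scale (t * t) b = 0" for t
      using hom[of t x y] unfolding deformed_mul_def a_def b_def
      by (simp add: N.add N.scale R.add R.scale L.add L.scale
          scale_right_distrib scale_right_diff_distrib algebra_simps)
    have "a = 0" "b = 0"
      using linear_quadratic_coeffs_zero[OF s, of a b] poly[of 1] poly[of s] by simp_all
    from \<open>a = 0\<close> have "\<omega> x y = mul (N x) y + mul x (N y) - N (mul x y)"
      unfolding a_def by (simp add: algebra_simps)
    with \<open>b = 0\<close> show ?thesis
      unfolding b_def by simp
  qed
  with mul N show ?thesis
    by (simp add: nijenhuis_operator_def)
qed

theorem mainTheorem5:
  fixes scale :: "'k::field \<Rightarrow> 'g::ab_group_add \<Rightarrow> 'g"
    and dot ast \<omega>1 \<omega>2 :: "'g \<Rightarrow> 'g \<Rightarrow> 'g"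
    and N :: "'g \<Rightarrow> 'g"
  assumes "(UNIV :: 'k set) \<noteq> {0, 1}"
    and "compatible_pre_lie_algebra scale dot ast"
    and "trivial_infinitesimal_deformation scale dot ast \<omega>1 \<omega>2"
    and "trivializes_deformation scale dot ast \<omega>1 \<omega>2 N"
  shows "compatible_nijenhuis_operator scale dot ast N"
proof -
  interpret compatible_pre_lie_algebra scale dot ast by (rule assms(2))
  have N: "Vector_Spaces.linear scale scale N"
    and hom: "\<And>t. compatible_pre_lie_hom
      scale (deformed_mul scale dot \<omega>1 t) (deformed_mul scale ast \<omega>2 t)
      scale dot ast (\<lambda>x. x + scale t (N x))"
    using assms(4) by (simp_all add: trivializes_deformation_def)
  have "nijenhuis_operator scale dot N"
    \<comment> \<open>With t left schematic, \<open>hom_dot\<close> yields the whole family of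
      equations over all t at once.\<close>
    using assms(1) dot.pre_lie_algebra_axioms N compatible_pre_lie_hom.hom_dot[OF hom]
    by (rule nijenhuis_operator_if_deformed_hom)
  moreover have "nijenhuis_operator scale ast N"
    using assms(1) ast.pre_lie_algebra_axioms N compatible_pre_lie_hom.hom_ast[OF hom]
    by (rule nijenhuis_operator_if_deformed_hom)
  ultimately show ?thesis
    using assms(2) by (simp add: compatible_nijenhuis_operator_def)
qed

end
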